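(* Let $G$ and $H$ be groups and let $\phi: G \to H$ be a centralizer-respecting homomorphism. Then the map $\mathcal{C}_\phi$ given by $\mathcal{C}_\phi(\mathbf{C}_G(X)) = \mathbf{C}_H(\phi(X)) = \phi(\mathbf{C}_G(X))$ is a homomorphism of centralizer lattices $\mathcal{C}(G) \to \mathcal{C}(H)$.
   Context: For a group $G$ and a subset $X \subseteq G$, $\mathbf{C}_G(X) = \{g \in G : xg = gx \text{ for all } x \in X\}$ is the centralizer of $X$ in $G$. A surjective group homomorphism $\phi: G \to H$ is centralizer-respecting if $\phi(\mathbf{C}_G(A)) = \mathbf{C}_H(\phi(A))$ for every subgroup $A \leq G$. The centralizer lattice $\mathcal{C}(G)$ of a group $G$ is the poset (under inclusion) of all subgroups of $G$ of the form $\mathbf{C}_G(X)$ for some $X \subseteq G$, together with the meet $\mathbf{C}_G(X) \wedge_{\mathbf{C}} \mathbf{C}_G(Y) = \mathbf{C}_G(\langle X, Y\rangle)$ (which equals $\mathbf{C}_G(X) \cap \mathbf{C}_G(Y)$), the join $\mathbf{C}_G(X) \vee_{\mathbf{C}} \mathbf{C}_G(Y) = \mathbf{C}_G\big(\mathbf{C}_G(\mathbf{C}_G(X)) \wedge_{\mathbf{C}} \mathbf{C}_G(\mathbf{C}_G(Y))\big)$ (the smallest centralizer in $G$ containing both $\mathbf{C}_G(X)$ and $\mathbf{C}_G(Y)$), and the involution $\mathbf{C}_G(\cdot)$. A centralizer lattice homomorphism (homomorphism of centralizer lattices) $f: \mathcal{C}(G) \to \mathcal{C}(H)$ is a map preserving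 the binary operations $\wedge_{\mathbf{C}}$ and $\vee_{\mathbf{C}}$ and respecting the centralizer involution, i.e. $f(\mathbf{C}_G(\mathbf{C}_G(X))) = \mathbf{C}_H(f(\mathbf{C}_G(X)))$ for all $X \leq G$. *)

theory Defs
  imports "HOL-Algebra.Generated_Groups"
begin

definition centralizer :: "('a, 'm) monoid_scheme \<Rightarrow> 'a set \<Rightarrow> 'a set" where
  "centralizer G X = {g \<in> carrier G. \<forall>x\<in>X. x \<otimes>\<^bsub>G\<^esub> g = g \<otimes>\<^bsub>G\<^esub> x}"

definition centralizer_respecting ::
  "('a, 'm) monoid_scheme \<Rightarrow> ('b, 'n) monoid_scheme \<Rightarrow> ('a \<Rightarrow> 'b) \<Rightarrow> bool" where
  "centralizer_respecting G H \<phi> \<longleftrightarrow>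
     \<phi> \<in> epi G H \<and>
     (\<forall>A. subgroup A G \<longrightarrow> \<phi> ` centralizer G A = centralizer H (\<phi> ` A))"

definition centralizer_lattice :: "('a, 'm) monoid_scheme \<Rightarrow> 'a set set" where
  "centralizer_lattice G = {centralizer G X | X. X \<subseteq> carrier G}"

text \<open>The meet of two centralizers is given through sets that they centralize. The lemma
  \<open>centralizer_meet_eq\<close> below shows that it does not depend on the choice of these sets.\<close>

definition centralizer_meet :: "('a, 'm) monoid_scheme \<Rightarrow> 'a set \<Rightarrow> 'a set \<Rightarrow> 'a set" where
  "centralizer_meet G K L =
     (THE M. \<exists>X Y. X \<subseteq> carrier G \<and> Y \<subseteq> carrier G \<and> K = centralizer G X \<and> L = centralizer G Y \<and>
                   M = centralizer G (generate G (X \<union> Y)))"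

definition centralizer_join :: "('a, 'm) monoid_scheme \<Rightarrow> 'a set \<Rightarrow> 'a set \<Rightarrow> 'a set" where
  "centralizer_join G K L =
     centralizer G (centralizer_meet G (centralizer G K) (centralizer G L))"

definition centralizer_lattice_hom ::
  "('a, 'm) monoid_scheme \<Rightarrow> ('b, 'n) monoid_scheme \<Rightarrow> ('a set \<Rightarrow> 'b set) \<Rightarrow> bool" where
  "centralizer_lattice_hom G H f \<longleftrightarrow>
     f \<in> centralizer_lattice G \<rightarrow> centralizer_lattice H \<and>
     (\<forall>K\<in>centralizer_lattice G. \<forall>L\<in>centralizer_lattice G.
        f (centralizer_meet G K L) = centralizer_meet H (f K) (f L) \<and>
        f (centralizer_join G K L) = centralizer_join H (f K) (f L)) \<and>
     (\<forall>X. subgroup X G \<longrightarrow>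
        f (centralizer G (centralizer G X)) = centralizer H (f (centralizer G X)))"

definition centralizer_lattice_map ::
  "('a, 'm) monoid_scheme \<Rightarrow> ('a \<Rightarrow> 'b) \<Rightarrow> 'a set \<Rightarrow> 'b set" where
  "centralizer_lattice_map G \<phi> = (\<lambda>K\<in>centralizer_lattice G. \<phi> ` K)"

lemma centralizer_subset_carrier: "centralizer G X \<subseteq> carrier G"
  by (auto simp: centralizer_def)

lemma centralizer_in_lattice:
  "X \<subseteq> carrier G \<Longrightarrow> centralizer G X \<in> centralizer_lattice G"
  by (auto simp: centralizer_lattice_def)

lemma centralizer_antimono: "X \<subseteq> Y \<Longrightarrow> centralizer G Y \<subseteq> centralizer G X"
  by (auto simp: centralizer_def)

lemma centralizer_Un: "centralizer G (X \<union> Y) = centralizer G X \<inter> centralizer G Y"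
  by (auto simp: centralizer_def)

lemma subset_centralizer_centralizer:
  "X \<subseteq> carrier G \<Longrightarrow> X \<subseteq> centralizer G (centralizer G X)"
  by (auto simp: centralizer_def)

lemma centralizer_triple:
  assumes "X \<subseteq> carrier G"
  shows "centralizer G (centralizer G (centralizer G X)) = centralizer G X"
  using subset_centralizer_centralizer[OF assms]
    subset_centralizer_centralizer[OF centralizer_subset_carrier[of G X]]
    centralizer_antimono
  by blast

context group
begin

lemma subgroup_centralizer:
  assumes "X \<subseteq> carrier G"
  shows "subgroup (centralizer G X) G"
proof (rule subgroupI)
  show "centralizer G X \<subseteq> carrier G"
    by (rule centralizer_subset_carrier)
  show "centralizer G X \<noteq> {}"
    using assms by (auto simp: centralizer_def intro!: exI[of _ \<one>])
next
  fix a assume a: "a \<in> centralizer G X"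
  show "inv a \<in> centralizer G X"
    unfolding centralizer_def
  proof (intro CollectI conjI ballI)
    show "inv a \<in> carrier G" using a by (simp add: centralizer_def)
    fix x assume x: "x \<in> X"
    have "a \<otimes> x = x \<otimes> a" "a \<in> carrier G" "x \<in> carrier G"
      using a x assms by (auto simp: centralizer_def)
    then show "x \<otimes> inv a = inv a \<otimes> x"
      by (metis inv_closed inv_solve_left inv_solve_right m_assoc m_closed)
  qed
next
  fix a b assume a: "a \<in> centralizer G X" and b: "b \<in> centralizer G X"
  show "a \<otimes> b \<in> centralizer G X"
    unfolding centralizer_def
  proof (intro CollectI conjI ballI)
    show "a \<otimes> b \<in> carrier G" using a b by (simp add: centralizer_def)
    fix x assume x: "x \<in> X"
    have "x \<otimes> a = a \<otimes> x" "x \<otimes> b = b \<otimes> x"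
      "a \<in> carrier G" "b \<in> carrier G" "x \<in> carrier G"
      using a b x assms by (auto simp: centralizer_def)
    then show "x \<otimes> (a \<otimes> b) = a \<otimes> b \<otimes> x"
      by (metis m_assoc)
  qed
qed

lemma centralizer_generate:
  assumes "X \<subseteq> carrier G"
  shows "centralizer G (generate G X) = centralizer G X"
proof
  show "centralizer G (generate G X) \<subseteq> centralizer G X"
    by (rule centralizer_antimono) (auto intro: generate.incl)
  have "generate G X \<subseteq> centralizer G (centralizer G X)"
    by (rule generate_subgroup_incl[OF subset_centralizer_centralizer[OF assms]
          subgroup_centralizer[OF centralizer_subset_carrier]])
  then have "centralizer G (centralizer G (centralizer G X)) \<subseteq> centralizer G (generate G X)"
    by (rule centralizer_antimono)
  then show "centralizer G X \<subseteq> centralizer G (generate G X)"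
    by (simp add: centralizer_triple[OF assms])
qed

lemma centralizer_meet_eq:
  assumes "X \<subseteq> carrier G" "Y \<subseteq> carrier G"
  shows "centralizer_meet G (centralizer G X) (centralizer G Y)
           = centralizer G (generate G (X \<union> Y))"
  unfolding centralizer_meet_def
proof (rule the_equality)
  show "\<exists>X' Y'. X' \<subseteq> carrier G \<and> Y' \<subseteq> carrier G \<and> centralizer G X = centralizer G X' \<and>
          centralizer G Y = centralizer G Y' \<and>
          centralizer G (generate G (X \<union> Y)) = centralizer G (generate G (X' \<union> Y'))"
    using assms by blast
  show "M = centralizer G (generate G (X \<union> Y))"
    if "\<exists>X' Y'. X' \<subseteq> carrier G \<and> Y' \<subseteq> carrier G \<and> centralizer G X = centralizer G X' \<and>
          centralizer G Y = centralizer G Y' \<and> M = centralizer G (generate G (X' \<union> Y'))" for M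
    using that assms by (auto simp: centralizer_generate centralizer_Un)
qed

lemma centralizer_meet_Int:
  assumes "K \<in> centralizer_lattice G" "L \<in> centralizer_lattice G"
  shows "centralizer_meet G K L = K \<inter> L"
  using assms
  by (auto simp: centralizer_lattice_def centralizer_meet_eq centralizer_generate centralizer_Un)

lemma centralizer_meet_in_lattice:
  assumes "K \<in> centralizer_lattice G" "L \<in> centralizer_lattice G"
  shows "centralizer_meet G K L \<in> centralizer_lattice G"
proof -
  obtain X Y where XY: "X \<subseteq> carrier G" "Y \<subseteq> carrier G" "K = centralizer G X" "L = centralizer G Y"
    using assms by (auto simp: centralizer_lattice_def)
  then have "centralizer_meet G K L = centralizer G (X \<union> Y)"
    using assms by (simp add: centralizer_meet_Int centralizer_Un)
  with XY show ?thesis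
    by (simp add: centralizer_in_lattice)
qed

lemma centralizer_join_least:
  assumes K: "K \<in> centralizer_lattice G" and L: "L \<in> centralizer_lattice G"
  shows "centralizer_join G K L \<in> centralizer_lattice G"
    and "K \<subseteq> centralizer_join G K L"
    and "L \<subseteq> centralizer_join G K L"
    and "\<And>M. \<lbrakk>M \<in> centralizer_lattice G; K \<subseteq> M; L \<subseteq> M\<rbrakk> \<Longrightarrow> centralizer_join G K L \<subseteq> M"
proof -
  have sub: "K \<subseteq> carrier G" "L \<subseteq> carrier G"
    using K L centralizer_subset_carrier by (fastforce simp: centralizer_lattice_def)+
  have eq: "centralizer_join G K L = centralizer G (centralizer G K \<inter> centralizer G L)"
    unfolding centralizer_join_def
    using sub by (simp add: centralizer_meet_Int centralizer_in_lattice)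
  show "centralizer_join G K L \<in> centralizer_lattice G"
    unfolding eq by (intro centralizer_in_lattice) (auto simp: centralizer_def)
  show "K \<subseteq> centralizer_join G K L" "L \<subseteq> centralizer_join G K L"
    unfolding eq using sub by (auto simp: centralizer_def)
  fix M assume M: "M \<in> centralizer_lattice G" "K \<subseteq> M" "L \<subseteq> M"
  then have "centralizer G M \<subseteq> centralizer G K \<inter> centralizer G L"
    using centralizer_antimono by blast
  then have "centralizer_join G K L \<subseteq> centralizer G (centralizer G M)"
    unfolding eq by (rule centralizer_antimono)
  also have "\<dots> = M"
    using M(1) by (auto simp: centralizer_lattice_def centralizer_triple)
  finally show "centralizer_join G K L \<subseteq> M" .
qed

end

end

theory Submission
  imports Defs
begin

text \<open>A set and the subgroup it generates have the same centralizer, and \<open>\<phi>\<close> commutes with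
  generation, so a centralizer-respecting \<open>\<phi>\<close> sends the centralizer of any subset to the
  centralizer of its image. The induced map therefore commutes with the involution, and it preserves
  meets because those are centralizers of unions; joins are meets conjugated by the involution.\<close>

lemma centralizer_respecting_image:
  assumes "group G" "group H" "centralizer_respecting G H \<phi>" and X: "X \<subseteq> carrier G"
  shows "\<phi> ` centralizer G X = centralizer H (\<phi> ` X)"
proof -
  interpret group_hom G H \<phi>
    using assms by (auto simp: group_hom_def group_hom_axioms_def centralizer_respecting_def epi_def)
  \<comment> \<open>The hypothesis on \<phi> speaks of subgroups only, so it is applied to
    \<open>generate G X\<close>.\<close>
  have "\<phi> ` centralizer G X = \<phi> ` centralizer G (generate G X)"
    by (simp add: G.centralizer_generate X)
  also have "\<dots> = centralizer H (\<phi> ` generate G X)"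
    using assms(3) G.generate_is_subgroup[OF X] by (simp add: centralizer_respecting_def)
  also have "\<dots> = centralizer H (generate H (\<phi> ` X))"
    by (simp add: generate_img X)
  also have "\<dots> = centralizer H (\<phi> ` X)"
    using X by (intro H.centralizer_generate) auto
  finally show ?thesis .
qed

theorem theorem1:
  fixes G :: "('a, 'm) monoid_scheme" and H :: "('b, 'n) monoid_scheme" and \<phi> :: "'a \<Rightarrow> 'b"
  assumes "group G" and "group H" and "centralizer_respecting G H \<phi>"
  shows "(\<forall>X. X \<subseteq> carrier G \<longrightarrow>
            centralizer_lattice_map G \<phi> (centralizer G X) = centralizer H (\<phi> ` X) \<and>
            centralizer H (\<phi> ` X) = \<phi> ` centralizer G X) \<and>
         centralizer_lattice_hom G H (centralizer_lattice_map G \<phi>)"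
proof -
  interpret G: group G by fact
  interpret H: group H by fact
  let ?f = "centralizer_lattice_map G \<phi>"
  have \<phi>_closed: "\<phi> ` X \<subseteq> carrier H" if "X \<subseteq> carrier G" for X
    using assms(3) that by (auto simp: centralizer_respecting_def epi_def hom_def)
  have image: "\<phi> ` centralizer G X = centralizer H (\<phi> ` X)" if "X \<subseteq> carrier G" for X
    using centralizer_respecting_image[OF assms that] .
  \<comment> \<open>\<open>?f\<close> takes images of centralizers, so its value cannot depend on
    the set \<open>X\<close> chosen to represent one.\<close>
  have f: "?f (centralizer G X) = centralizer H (\<phi> ` X)" if "X \<subseteq> carrier G" for X
    using that by (simp add: centralizer_lattice_map_def centralizer_in_lattice image)
  have closed: "?f K \<in> centralizer_lattice H" if "K \<in> centralizer_lattice G" for K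
    using that by (auto simp: centralizer_lattice_def[of G] f \<phi>_closed centralizer_in_lattice)
  have sub: "K \<subseteq> carrier G" if "K \<in> centralizer_lattice G" for K
    using that centralizer_subset_carrier by (fastforce simp: centralizer_lattice_def)
  \<comment> \<open>A centralizer \<open>K\<close> is itself a subset of \<open>G\<close>, so
    \<open>f\<close> applies with \<open>X\<close> taken to be \<open>K\<close>; on the lattice
    \<open>?f K\<close> is the image of \<open>K\<close>.\<close>
  have involution: "?f (centralizer G K) = centralizer H (?f K)"
    if "K \<in> centralizer_lattice G" for K
    using that f[OF sub[OF that]] by (simp add: centralizer_lattice_map_def)
  have meet: "?f (centralizer_meet G K L) = centralizer_meet H (?f K) (?f L)"
    if KL: "K \<in> centralizer_lattice G" "L \<in> centralizer_lattice G" for K L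
  proof -
    obtain X Y where XY: "X \<subseteq> carrier G" "K = centralizer G X" "Y \<subseteq> carrier G" "L = centralizer G Y"
      using KL by (auto simp: centralizer_lattice_def)
    \<comment> \<open>Images need not commute with intersections, but they do commute with unions,
      so the meet is rewritten as the centralizer of a union before \<phi> is applied.\<close>
    have "?f (centralizer_meet G K L) = ?f (centralizer G (X \<union> Y))"
      using KL XY by (simp add: G.centralizer_meet_Int centralizer_Un)
    also have "\<dots> = centralizer H (\<phi> ` X \<union> \<phi> ` Y)"
      using XY by (simp add: f image_Un)
    also have "\<dots> = ?f K \<inter> ?f L"
      using XY by (simp add: f centralizer_Un)
    also have "\<dots> = centralizer_meet H (?f K) (?f L)"
      using KL by (simp add: H.centralizer_meet_Int closed)
    finally show ?thesis .
  qed
  have join: "?f (centralizer_join G K L) = centralizer_join H (?f K) (?f L)"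
    if KL: "K \<in> centralizer_lattice G" "L \<in> centralizer_lattice G" for K L
    \<comment> \<open>\<open>involution\<close> moves \<open>?f\<close> past the outer centralizer,
      which requires the inner meet to lie in the lattice; \<open>meet\<close> then splits it, and
      \<open>involution\<close> is used again on \<open>K\<close> and \<open>L\<close>.\<close>
    using KL unfolding centralizer_join_def
    by (simp add: involution meet G.centralizer_meet_in_lattice centralizer_in_lattice sub)
  show ?thesis
    \<comment> \<open>The double centralizer condition is \<open>involution\<close> at the lattice
      element \<open>centralizer G X\<close>.\<close>
    unfolding centralizer_lattice_hom_def
    using f image closed meet join involution
    by (auto simp: centralizer_in_lattice subgroup.subset)
qed

end
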